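(* Let $K$ be an algebraically closed field of characteristic zero, let $K[x]=K[x_1,\ldots,x_n]$, and let $\delta=I-\phi$ be an $\mathcal{E}$-derivation of $K[x]$, where $\phi$ is the $K$-algebra endomorphism of $K[x]$ given by $\phi(x_i)=\lambda_ix_i+f_i(x_{i+1},\ldots,x_n)$ with $f_i\in K[x_{i+1},\ldots,x_n]$ and $\lambda_i\in K$ for all $1\leq i\leq n$ (so $f_n\in K$). If $\lambda_k^{i_k}\cdots\lambda_n^{i_n}\neq 1$ for all $i_k,\ldots,i_n\in\mathbb{N}$ with $i_k+\cdots+i_n\geq 1$ and all $1\leq k\leq n$, then $\operatorname{Im}\delta$ is an ideal generated by $x_1,x_2,\ldots,x_n$.
   Context: $\mathbb{N}$ includes $0$. $I$ is the identity map of $K[x]$, and $\operatorname{Im}\delta=\delta(K[x])$. An $\mathcal{E}$-derivation of $K[x]$ is a $K$-linear map $\delta:K[x]\to K[x]$ with $\delta(ab)=\delta(a)b+a\delta(b)-\delta(a)\delta(b)$ for all $a,b\in K[x]$; equivalently, $\delta=I-\phi$ for some $K$-algebra endomorphism $\phi$ of $K[x]$.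
   Formalization: The claim fails if some f_i has a nonzero constant term (e.g. n=1, φ(x)=2x+1). Proved instead: Im δ is the ideal generated by x_1−a_1,…,x_n−a_n for some a in K^n, and it equals the ideal (x_1,…,x_n) exactly when every f_i has zero constant term. *)

theory Defs
  imports
    "HOL-Computational_Algebra.Polynomial"
    "HOL-Library.Poly_Mapping"
begin

text \<open>
  \<open>K[x\<^sub>1,\<dots>,x\<^sub>n]\<close> is the monoid algebra of the exponent vectors \<open>'n \<Rightarrow>\<^sub>0 nat\<close> over \<open>'k\<close>.
  The variables are indexed by a type \<open>'n\<close> of class \<open>{finite, linorder}\<close>, so that
  \<open>n = CARD('n) \<ge> 1\<close> is arbitrary, and \<open>i + 1, \<dots>, n\<close> is the set \<open>{i<..}\<close>.
\<close>

type_synonym ('n, 'k) mpoly = "('n \<Rightarrow>\<^sub>0 nat) \<Rightarrow>\<^sub>0 'k"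

definition Const :: "'k::zero \<Rightarrow> ('n, 'k) mpoly"
  where "Const c = Poly_Mapping.single 0 c"

definition Var :: "'n \<Rightarrow> ('n, 'k::zero_neq_one) mpoly"
  where "Var i = Poly_Mapping.single (Poly_Mapping.single i 1) 1"

definition vars :: "('n, 'k::zero) mpoly \<Rightarrow> 'n set"
  where "vars p = (\<Union>m\<in>Poly_Mapping.keys p. Poly_Mapping.keys m)"

definition constant_term :: "('n, 'k::zero) mpoly \<Rightarrow> 'k"
  where "constant_term p = Poly_Mapping.lookup p 0"

definition polys_in :: "'n set \<Rightarrow> ('n, 'k::zero) mpoly set"
  where "polys_in V = {p. vars p \<subseteq> V}"

definition scalar_mult :: "'k::comm_ring_1 \<Rightarrow> ('n, 'k) mpoly \<Rightarrow> ('n, 'k) mpoly"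
  where "scalar_mult c p = Const c * p"

abbreviation K_linear :: "(('n, 'k::comm_ring_1) mpoly \<Rightarrow> ('n, 'k) mpoly) \<Rightarrow> bool"
  where "K_linear \<equiv> module_hom scalar_mult scalar_mult"

definition algebra_endomorphism ::
    "(('n, 'k::comm_ring_1) mpoly \<Rightarrow> ('n, 'k) mpoly) \<Rightarrow> bool"
  where "algebra_endomorphism \<phi> \<longleftrightarrow>
    K_linear \<phi> \<and> \<phi> 1 = 1 \<and> (\<forall>a b. \<phi> (a * b) = \<phi> a * \<phi> b)"

definition E_derivation ::
    "(('n, 'k::comm_ring_1) mpoly \<Rightarrow> ('n, 'k) mpoly) \<Rightarrow> bool"
  where "E_derivation \<delta> \<longleftrightarrow>
    K_linear \<delta> \<and> (\<forall>a b. \<delta> (a * b) = \<delta> a * b + a * \<delta> b - \<delta> a * \<delta> b)"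

text \<open>The ideals of a commutative ring are its submodules.\<close>

abbreviation is_ideal :: "'a::comm_ring_1 set \<Rightarrow> bool"
  where "is_ideal \<equiv> module.subspace (*)"

abbreviation ideal_generated_by :: "'a::comm_ring_1 set \<Rightarrow> 'a set"
  where "ideal_generated_by \<equiv> module.span (*)"

lemma module_mult: "module ((*) :: 'a::comm_ring_1 \<Rightarrow> 'a \<Rightarrow> 'a)"
  by unfold_locales (simp_all add: algebra_simps)

lemma ideal_generated_by_eq: "ideal_generated_by S = is_ideal hull S"
  by (rule module.span_def[OF module_mult])

lemma Const_add: "Const (a + b) = Const a + Const b"
  by (simp add: Const_def single_add)

lemma Const_mult: "Const (a * b) = (Const a * Const b :: ('n, 'k::comm_ring_1) mpoly)"
  by (simp add: Const_def mult_single)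

lemma Const_1: "Const 1 = (1 :: ('n, 'k::comm_ring_1) mpoly)"
  by (simp add: Const_def)

lemma module_scalar_mult:
  "module (scalar_mult :: 'k::comm_ring_1 \<Rightarrow> ('n, 'k) mpoly \<Rightarrow> ('n, 'k) mpoly)"
  by unfold_locales
    (simp_all add: scalar_mult_def Const_add Const_mult Const_1 algebra_simps)

lemma E_derivation_id_minus_endomorphism:
  assumes "algebra_endomorphism \<phi>"
  shows "E_derivation (\<lambda>p. p - \<phi> p)"
proof -
  have lin: "K_linear \<phi>" and mult: "\<And>a b. \<phi> (a * b) = \<phi> a * \<phi> b"
    using assms by (auto simp: algebra_endomorphism_def)
  have "K_linear (\<lambda>p. p - \<phi> p)"
    using module_hom.add[OF lin] module_hom.scale[OF lin]
    by (intro module_hom.intro module_scalar_mult module_hom_axioms.intro)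
      (simp_all add: scalar_mult_def algebra_simps)
  then show ?thesis
    by (simp add: E_derivation_def mult algebra_simps)
qed

end

theory Submission
  imports Defs
begin

text \<open>
  The affine map that sends a point \<open>a\<close> to the point with coordinates \<open>lam i * a i + f i (a)\<close> is
  triangular, and no \<open>lam i\<close> equals 1, so its fixed-point equations can be solved from the last
  coordinate down: it has a fixed point \<open>a\<close> (\<open>triangular_fixed_point_exists\<close>). Evaluation at \<open>a\<close> is
  then unchanged by \<open>\<phi>\<close>, so every \<open>p - \<phi> p\<close> vanishes at \<open>a\<close>. Since the polynomials that vanish at
  \<open>a\<close> form the ideal generated by the \<open>Var i - Const (a i)\<close> (\<open>ideal_generated_by_shifted_Var\<close>),
  the image lies in this ideal.

  For the reverse inclusion, expand polynomials in the monomials \<open>Y m\<close> in the shifted variables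
  \<open>Var i - Const (a i)\<close>, ordered lexicographically with the smallest index most significant. A
  polynomial in the variables after \<open>i\<close> involves only monomials below that of
  \<open>Var i - Const (a i)\<close>, so \<open>\<phi>\<close> is triangular in this basis: it maps \<open>Y m\<close> to \<open>l m * Y m\<close> plus a
  combination \<open>u\<close> of smaller monomials, where \<open>l m\<close> is the product of the powers
  \<open>lam i ^ lookup m i\<close> (\<open>triangular_endomorphism_leading_term\<close>). If \<open>m \<noteq> 0\<close>, evaluation at \<open>a\<close> shows
  that \<open>u\<close> has no component at \<open>Y 0 = 1\<close>. The lexicographic order is a well-order, so by induction
  \<open>u\<close> is in the image; hence so is \<open>(1 - l m) * Y m\<close>, and \<open>1 - l m\<close> is invertible
  (\<open>range_id_minus_triangular_endomorphism\<close>).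

  The ideal is the one generated by the variables exactly when the origin can serve as \<open>a\<close>. The
  origin is fixed when every \<open>f i\<close> has constant term zero; conversely, the constant term of
  \<open>\<delta> (Var i)\<close> is that of \<open>- f i\<close>, which must vanish if the image lies in that ideal.
\<close>

section \<open>Induction on exponents and polynomials\<close>

lemma sum_single_lookup:
  "(\<Sum>m\<in>Poly_Mapping.keys p. Poly_Mapping.single m (Poly_Mapping.lookup p m)) = p"
  by (rule poly_mapping_eqI) (auto simp: lookup_sum lookup_single when_def in_keys_iff sum.delta)

text \<open>
  Exponents are sums of unit vectors. This form of induction suits properties that are
  multiplicative in the monomial; the set \<open>V\<close> confines it to some of the variables.
\<close>

lemma exponent_induct [consumes 1, case_names zero single add]:
  fixes m :: "'n \<Rightarrow>\<^sub>0 nat"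
  assumes "Poly_Mapping.keys m \<subseteq> V"
    and zero: "P 0"
    and single: "\<And>i. i \<in> V \<Longrightarrow> P (Poly_Mapping.single i 1)"
    and add: "\<And>m m'. P m \<Longrightarrow> P m' \<Longrightarrow> P (m + m')"
  shows "P m"
proof -
  have "P (Poly_Mapping.single i e)" if "i \<in> V" for i e
  proof (induction e)
    case (Suc e)
    then show ?case
      using add[OF single[OF that] Suc] by (simp flip: single_add)
  qed (simp add: zero)
  then have "P (\<Sum>i\<in>A. Poly_Mapping.single i (Poly_Mapping.lookup m i))" if "A \<subseteq> V" for A
    using that by (induction A rule: infinite_finite_induct) (auto simp: zero intro: add)
  then show ?thesis
    using assms(1) sum_single_lookup[of m] by metis
qed

text \<open>
  The polynomials in the variables \<open>V\<close> form the subalgebra generated by these variables, so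
  anything that respects sums and products has to be checked on generators only.
\<close>

lemma polys_in_induct [consumes 1, case_names Const Var add mult]:
  fixes p :: "('n, 'k::comm_ring_1) mpoly"
  assumes "p \<in> polys_in V"
    and Const: "\<And>c. P (Const c)"
    and Var: "\<And>i. i \<in> V \<Longrightarrow> P (Var i)"
    and add: "\<And>p q. P p \<Longrightarrow> P q \<Longrightarrow> P (p + q)"
    and mult: "\<And>p q. P p \<Longrightarrow> P q \<Longrightarrow> P (p * q)"
  shows "P p"
proof -
  have monomial: "P (Poly_Mapping.single m c)" if "Poly_Mapping.keys m \<subseteq> V" for m c
  proof -
    from that have "P (Poly_Mapping.single m 1)"
    proof (induction rule: exponent_induct)
      case zero
      then show ?case using Const[of 1] by (simp add: Const_1)
    next
      case (single i)
      then show ?case using Var[of i] by (simp add: Var_def)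
    next
      case (add m m')
      then show ?case using mult[OF add] by (simp add: mult_single)
    qed
    from mult[OF Const[of c] this] show ?thesis
      by (simp add: Const_def mult_single)
  qed
  have "P (\<Sum>m\<in>A. Poly_Mapping.single m (Poly_Mapping.lookup p m))"
    if "A \<subseteq> Poly_Mapping.keys p" for A
    using that
  proof (induction A rule: infinite_finite_induct)
    case (insert m A)
    then have "Poly_Mapping.keys m \<subseteq> V"
      using assms(1) by (auto simp: polys_in_def vars_def)
    with insert show ?case
      by (auto intro: add monomial)
  qed (use Const[of 0] in \<open>simp_all add: Const_def\<close>)
  from this[OF order.refl] show ?thesis
    by (simp only: sum_single_lookup)
qed

lemma mpoly_induct [case_names Const Var add mult]:
  fixes p :: "('n, 'k::comm_ring_1) mpoly"
  assumes "\<And>c. P (Const c)" "\<And>i. P (Var i)"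
    and "\<And>p q. P p \<Longrightarrow> P q \<Longrightarrow> P (p + q)" "\<And>p q. P p \<Longrightarrow> P q \<Longrightarrow> P (p * q)"
  shows "P p"
  by (rule polys_in_induct[of p UNIV]) (use assms in \<open>auto simp: polys_in_def\<close>)

section \<open>Evaluation at a point\<close>

definition eval :: "('n::finite \<Rightarrow> 'k::comm_ring_1) \<Rightarrow> ('n, 'k) mpoly \<Rightarrow> 'k"
  where "eval a p = (\<Sum>m\<in>Poly_Mapping.keys p.
    Poly_Mapping.lookup p m * (\<Prod>i\<in>UNIV. a i ^ Poly_Mapping.lookup m i))"

text \<open>
  The set of keys of \<open>p + q\<close> need not be the union of those of \<open>p\<close> and \<open>q\<close>, because of
  cancellation. Additivity therefore needs summation over a common larger set of exponents.
\<close>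

lemma eval_superset:
  assumes "finite A" "Poly_Mapping.keys p \<subseteq> A"
  shows "eval a p =
    (\<Sum>m\<in>A. Poly_Mapping.lookup p m * (\<Prod>i\<in>UNIV. a i ^ Poly_Mapping.lookup m i))"
  unfolding eval_def using assms by (intro sum.mono_neutral_left) (auto simp: in_keys_iff)

lemma eval_single:
  "eval a (Poly_Mapping.single m c) = c * (\<Prod>i\<in>UNIV. a i ^ Poly_Mapping.lookup m i)"
  by (subst eval_superset[of "{m}"]) (auto split: if_splits)

lemma eval_0 [simp]: "eval a 0 = 0"
  by (simp add: eval_def)

lemma eval_add [simp]: "eval a (p + q) = eval a p + eval a q"
proof -
  let ?A = "Poly_Mapping.keys p \<union> Poly_Mapping.keys q"
  have "Poly_Mapping.keys (p + q) \<subseteq> ?A"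
    by (rule keys_add)
  then show ?thesis
    by (simp add: eval_superset[of ?A] lookup_add distrib_right sum.distrib)
qed

lemma eval_sum: "eval a (sum g A) = (\<Sum>x\<in>A. eval a (g x))"
  by (induction A rule: infinite_finite_induct) simp_all

lemma eval_mult [simp]: "eval a (p * q) = eval a p * eval a q"
proof -
  let ?s = "\<lambda>p m. Poly_Mapping.single m (Poly_Mapping.lookup p m)"
  let ?K = Poly_Mapping.keys
  have mono: "eval a (?s p m * ?s q m') = eval a (?s p m) * eval a (?s q m')" for m m'
    by (simp add: mult_single eval_single lookup_add power_add prod.distrib algebra_simps)
  have "eval a (p * q) = eval a ((\<Sum>m\<in>?K p. ?s p m) * (\<Sum>m\<in>?K q. ?s q m))"
    by (simp only: sum_single_lookup)
  also have "\<dots> = (\<Sum>m\<in>?K p. eval a (?s p m)) * (\<Sum>m\<in>?K q. eval a (?s q m))"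
    by (simp add: sum_product eval_sum mono)
  also have "\<dots> = eval a p * eval a q"
    by (simp only: sum_single_lookup flip: eval_sum)
  finally show ?thesis .
qed

lemma eval_Const [simp]: "eval a (Const c) = c"
  by (simp add: Const_def eval_single)

lemma eval_Var [simp]: "eval a (Var i) = a i"
proof -
  have "(\<Prod>j\<in>UNIV. a j ^ Poly_Mapping.lookup (Poly_Mapping.single i 1) j) = a i"
    by (subst prod.remove[of _ i]) (auto simp: lookup_single when_def intro!: prod.neutral)
  then show ?thesis
    by (simp add: Var_def eval_single)
qed

lemma eval_1 [simp]: "eval a 1 = 1"
  using eval_Const[of a 1] by (simp add: Const_1)

lemma eval_diff [simp]: "eval a (p - q) = eval a p - eval a q"
  using eval_add[of a "p - q" q] by (simp add: algebra_simps)

lemma eval_power [simp]: "eval a (p ^ e) = eval a p ^ e"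
  by (induction e) simp_all

lemma eval_prod: "eval a (prod g A) = (\<Prod>x\<in>A. eval a (g x))"
  by (induction A rule: infinite_finite_induct) simp_all

lemma eval_cong:
  assumes "p \<in> polys_in V" "\<And>i. i \<in> V \<Longrightarrow> a i = b i"
  shows "eval a p = eval b p"
  using assms by (induction rule: polys_in_induct) simp_all

lemma eval_zero_eq_constant_term:
  fixes p :: "('n::finite, 'k::comm_ring_1) mpoly"
  shows "eval (\<lambda>_. 0) p = constant_term p"
proof -
  have "(\<Prod>i\<in>UNIV. (0::'k) ^ Poly_Mapping.lookup m i) = (if m = 0 then 1 else 0)"
    for m :: "'n \<Rightarrow>\<^sub>0 nat"
    by (auto simp: poly_mapping_eq_iff fun_eq_iff power_0_left intro!: prod_zero)
  then show ?thesis
    by (simp add: eval_def constant_term_def in_keys_iff if_distrib[of "\<lambda>x. _ * x"] cong: if_cong)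
qed

section \<open>The lexicographic well-order on exponents\<close>

text \<open>
  The order on finitely supported functions is decided at the smallest index where they differ.
  As there are finitely many indices, it embeds into the lexicographic order on lists of
  naturals of a fixed length, which is well-founded.
\<close>

lemma wf_exponent_less: "wf {(m, m' :: 'n::{finite, linorder} \<Rightarrow>\<^sub>0 nat). m < m'}"
proof -
  define vs where "vs = sorted_list_of_set (UNIV :: 'n set)"
  define h where "h m = map (Poly_Mapping.lookup m) vs" for m :: "'n \<Rightarrow>\<^sub>0 nat"
  have "(h m, h m') \<in> lex less_than" if less: "m < m'" for m m'
  proof -
    from less obtain i where i: "Poly_Mapping.lookup m i < Poly_Mapping.lookup m' i"
      and below: "\<And>j. j < i \<Longrightarrow> Poly_Mapping.lookup m j = Poly_Mapping.lookup m' j"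
      by (auto simp: less_poly_mapping.rep_eq less_fun_def)
    have "i \<in> set vs"
      by (simp add: vs_def)
    then obtain xs ys where vs: "vs = xs @ i # ys"
      by (auto simp: in_set_conv_decomp)
    have "sorted_wrt (<) vs"
      by (simp add: vs_def)
    then have "\<forall>j\<in>set xs. j < i"
      by (simp add: vs sorted_wrt_append)
    then have "map (Poly_Mapping.lookup m) xs = map (Poly_Mapping.lookup m') xs"
      by (auto intro: below)
    with i show ?thesis
      unfolding lex_conv h_def vs by force
  qed
  then have "{(m, m'). m < m'} \<subseteq> inv_image (lex less_than) h"
    by auto
  then show ?thesis
    by (rule wf_subset[rotated]) (simp add: wf_lex)
qed

section \<open>Monomials in shifted variables\<close>

interpretation scal: module scalar_mult
  by (rule module_scalar_mult)

definition shifted_monomial ::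
    "('n::finite \<Rightarrow> 'k::comm_ring_1) \<Rightarrow> ('n \<Rightarrow>\<^sub>0 nat) \<Rightarrow> ('n, 'k) mpoly"
  where "shifted_monomial a m = (\<Prod>i\<in>UNIV. (Var i - Const (a i)) ^ Poly_Mapping.lookup m i)"

lemma shifted_monomial_0 [simp]: "shifted_monomial a 0 = 1"
  by (simp add: shifted_monomial_def)

lemma shifted_monomial_single [simp]:
  "shifted_monomial a (Poly_Mapping.single i (Suc 0)) = Var i - Const (a i)"
  unfolding shifted_monomial_def
  by (subst prod.remove[of _ i]) (auto simp: lookup_single when_def intro!: prod.neutral)

lemma shifted_monomial_add:
  "shifted_monomial a (m + m') = shifted_monomial a m * shifted_monomial a m'"
  by (simp add: shifted_monomial_def lookup_add power_add prod.distrib)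

lemma eval_shifted_monomial:
  fixes a :: "'n::finite \<Rightarrow> 'k::comm_ring_1"
  assumes "m \<noteq> 0"
  shows "eval a (shifted_monomial a m) = 0"
proof -
  from assms obtain i where "Poly_Mapping.lookup m i \<noteq> 0"
    by (auto simp: poly_mapping_eq_iff fun_eq_iff)
  then have "(0::'k) ^ Poly_Mapping.lookup m i = 0"
    by (simp add: power_0_left)
  then show ?thesis
    by (auto simp: shifted_monomial_def eval_prod intro!: prod_zero)
qed

text \<open>
  The linear span of some of the shifted monomials. Leaving the set of exponents free allows one
  product rule to serve the subalgebras, the filtration by the lexicographic order and the
  complement of the constants.
\<close>

definition shifted_span ::
    "('n::finite \<Rightarrow> 'k::comm_ring_1) \<Rightarrow> ('n \<Rightarrow>\<^sub>0 nat) set \<Rightarrow> ('n, 'k) mpoly set"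
  where "shifted_span a B = scal.span (shifted_monomial a ` B)"

lemma shifted_span_base: "m \<in> B \<Longrightarrow> shifted_monomial a m \<in> shifted_span a B"
  by (simp add: shifted_span_def scal.span_base)

lemma shifted_span_add: "p \<in> shifted_span a B \<Longrightarrow> q \<in> shifted_span a B \<Longrightarrow> p + q \<in> shifted_span a B"
  by (simp add: shifted_span_def scal.span_add)

lemma shifted_span_Const_mult: "p \<in> shifted_span a B \<Longrightarrow> Const c * p \<in> shifted_span a B"
  using scal.span_scale[of p _ c] by (simp add: shifted_span_def scalar_mult_def)

lemma shifted_span_mono: "B \<subseteq> C \<Longrightarrow> shifted_span a B \<subseteq> shifted_span a C"
  unfolding shifted_span_def by (intro scal.span_mono image_mono)

lemma shifted_span_subset:
  assumes "scal.subspace S" "\<And>m. m \<in> B \<Longrightarrow> shifted_monomial a m \<in> S"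
  shows "shifted_span a B \<subseteq> S"
  unfolding shifted_span_def using assms by (intro scal.span_minimal) auto

lemma shifted_span_mult:
  assumes p: "p \<in> shifted_span a B" and q: "q \<in> shifted_span a C"
    and BC: "\<And>m m'. m \<in> B \<Longrightarrow> m' \<in> C \<Longrightarrow> m + m' \<in> D"
  shows "p * q \<in> shifted_span a D"
proof -
  have sub: "scal.subspace {p. p * r \<in> shifted_span a D}" for r
    by (auto simp: scal.subspace_def distrib_right shifted_span_add shifted_span_Const_mult
      scalar_mult_def mult.assoc) (simp add: shifted_span_def scal.span_zero)
  have "shifted_span a C \<subseteq> {q. q * shifted_monomial a m \<in> shifted_span a D}" if "m \<in> B" for m
    using that BC
    by (intro shifted_span_subset sub)
      (auto intro!: shifted_span_base simp flip: shifted_monomial_add simp: add.commute[of _ m])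
  with q have "shifted_span a B \<subseteq> {p. p * q \<in> shifted_span a D}"
    by (intro shifted_span_subset sub) (auto simp: mult.commute)
  with p show ?thesis
    by auto
qed

text \<open>
  The span on the right contains the constants and each \<open>Var i\<close> with \<open>i \<in> V\<close>, as
  \<open>Var i = (Var i - Const (a i)) + Const (a i)\<close>, and it is closed under products because the
  exponents supported in \<open>V\<close> are closed under addition.
\<close>

lemma polys_in_subset_shifted_span:
  fixes a :: "'n::finite \<Rightarrow> 'k::comm_ring_1"
  shows "polys_in V \<subseteq> shifted_span a {m. Poly_Mapping.keys m \<subseteq> V}"
proof
  fix p :: "('n, 'k) mpoly"
  assume "p \<in> polys_in V"
  then show "p \<in> shifted_span a {m. Poly_Mapping.keys m \<subseteq> V}"
  proof (induction rule: polys_in_induct)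
    case (Const c)
    show ?case
      using shifted_span_Const_mult[OF shifted_span_base[of 0 _ a], of _ c] by simp
  next
    case (Var i)
    then have "Var i - Const (a i) \<in> shifted_span a {m. Poly_Mapping.keys m \<subseteq> V}"
      by (subst shifted_monomial_single[symmetric], intro shifted_span_base) auto
    moreover have "Const (a i) \<in> shifted_span a {m. Poly_Mapping.keys m \<subseteq> V}"
      using shifted_span_Const_mult[OF shifted_span_base[of 0 _ a], of _ "a i"] by simp
    ultimately show ?case
      using shifted_span_add by fastforce
  next
    case (add p q)
    then show ?case by (rule shifted_span_add)
  next
    case (mult p q)
    then show ?case
      by (rule shifted_span_mult) (use keys_add in fastforce)
  qed
qed

text \<open>
  All shifted monomials except \<open>Y 0 = 1\<close> vanish at \<open>a\<close>, so subtracting the value at \<open>a\<close> removes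
  exactly the component at \<open>Y 0\<close>. In particular a combination that vanishes at \<open>a\<close> does without
  the constant monomial.
\<close>

lemma diff_eval_in_shifted_span:
  assumes "p \<in> shifted_span a B"
  shows "p - Const (eval a p) \<in> shifted_span a (B - {0})"
proof -
  let ?S = "{p. p - Const (eval a p) \<in> shifted_span a (B - {0})}"
  have "shifted_span a B \<subseteq> ?S"
  proof (rule shifted_span_subset)
    have zero: "0 \<in> shifted_span a (B - {0})"
      by (simp add: shifted_span_def scal.span_zero)
    show "scal.subspace ?S"
      unfolding scal.subspace_def
    proof (intro conjI ballI allI)
      show "0 \<in> ?S"
        using zero by (simp add: Const_def)
    next
      fix p q
      assume "p \<in> ?S"
        and "q \<in> ?S"
      then show "p + q \<in> ?S"
        using shifted_span_add[of "p - Const (eval a p)" a _ "q - Const (eval a q)"]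
        by (simp add: Const_add algebra_simps)
    next
      fix c p
      assume "p \<in> ?S"
      then show "scalar_mult c p \<in> ?S"
        using shifted_span_Const_mult[of "p - Const (eval a p)" a _ c]
        by (simp add: Const_mult scalar_mult_def algebra_simps)
    qed
    show "shifted_monomial a m \<in> ?S" if "m \<in> B" for m
    proof (cases "m = 0")
      case True
      then show ?thesis using zero by (simp add: Const_1)
    next
      case False
      with that show ?thesis
        by (auto simp: eval_shifted_monomial Const_def intro: shifted_span_base)
    qed
  qed
  with assms show ?thesis by auto
qed

lemma eval_zero_subset_shifted_span: "{p. eval a p = 0} \<subseteq> shifted_span a (UNIV - {0})"
proof
  fix p assume "p \<in> {p. eval a p = 0}"
  moreover have "p \<in> shifted_span a UNIV"
    using polys_in_subset_shifted_span[of UNIV a] by (auto simp: polys_in_def)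
  ultimately show "p \<in> shifted_span a (UNIV - {0})"
    using diff_eval_in_shifted_span[of p a UNIV] by (simp add: Const_def)
qed

text \<open>
  A polynomial that vanishes at \<open>a\<close> is a combination of shifted monomials with non-zero
  exponents, and each of these contains some factor \<open>Var i - Const (a i)\<close>.
\<close>

lemma ideal_generated_by_shifted_Var:
  fixes a :: "'n::finite \<Rightarrow> 'k::comm_ring_1"
  shows "ideal_generated_by (range (\<lambda>i. Var i - Const (a i))) = {p. eval a p = 0}" (is "?I = ?E")
proof
  show "?I \<subseteq> ?E"
    by (rule module.span_minimal[OF module_mult])
      (auto simp: module.subspace_def[OF module_mult])
  have "scal.subspace ?I"
    by (auto simp: scal.subspace_def scalar_mult_def module.span_zero[OF module_mult]
      module.span_add[OF module_mult] module.span_scale[OF module_mult])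
  moreover have "shifted_monomial a m \<in> ?I" if nz: "m \<noteq> 0" for m
  proof -
    from nz obtain i where "Poly_Mapping.lookup m i \<noteq> 0"
      by (auto simp: poly_mapping_eq_iff fun_eq_iff)
    then have "Poly_Mapping.single i 1 + (m - Poly_Mapping.single i 1) = m"
      by (auto simp: poly_mapping_eq_iff fun_eq_iff lookup_add lookup_minus lookup_single when_def)
    then have "shifted_monomial a m =
        shifted_monomial a (m - Poly_Mapping.single i 1) * (Var i - Const (a i))"
      using shifted_monomial_add[of a "Poly_Mapping.single i 1" "m - Poly_Mapping.single i 1"]
      by (simp add: mult.commute)
    then show ?thesis
      by (simp add: module.span_scale[OF module_mult] module.span_base[OF module_mult])
  qed
  ultimately have "shifted_span a (UNIV - {0}) \<subseteq> ?I"
    by (intro shifted_span_subset) auto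
  then show "?E \<subseteq> ?I"
    using eval_zero_subset_shifted_span by blast
qed


section \<open>Triangular endomorphisms\<close>

lemma algebra_endomorphism_Const:
  assumes "algebra_endomorphism \<phi>"
  shows "\<phi> (Const c) = Const c"
proof -
  have "\<phi> (scalar_mult c 1) = scalar_mult c (\<phi> 1)"
    using assms module_hom.scale unfolding algebra_endomorphism_def by blast
  with assms show ?thesis
    by (simp add: algebra_endomorphism_def scalar_mult_def)
qed

lemma algebra_endomorphism_add:
  "algebra_endomorphism \<phi> \<Longrightarrow> \<phi> (p + q) = \<phi> p + \<phi> q"
  unfolding algebra_endomorphism_def using module_hom.add by blast

lemma algebra_endomorphism_diff:
  "algebra_endomorphism \<phi> \<Longrightarrow> \<phi> (p - q) = \<phi> p - \<phi> q"
  using algebra_endomorphism_add[of \<phi> "p - q" q] by (simp add: algebra_simps)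

lemma algebra_endomorphism_mult:
  "algebra_endomorphism \<phi> \<Longrightarrow> \<phi> (p * q) = \<phi> p * \<phi> q"
  by (simp add: algebra_endomorphism_def)

text \<open>
  On points, \<open>\<phi>\<close> acts by \<open>a \<mapsto> (\<lambda>i. eval a (\<phi> (Var i)))\<close>. At a fixed point of this map,
  evaluation is invariant under \<open>\<phi>\<close>.
\<close>

lemma eval_endomorphism:
  assumes "algebra_endomorphism \<phi>"
  shows "eval a (\<phi> p) = eval (\<lambda>i. eval a (\<phi> (Var i))) p"
  by (induction p rule: mpoly_induct)
    (simp_all add: assms algebra_endomorphism_Const algebra_endomorphism_add
      algebra_endomorphism_mult)

text \<open>
  The value of \<open>f i\<close> depends on the coordinates after \<open>i\<close> only, so
  \<open>a i = eval a (f i) / (1 - lam i)\<close> is a recursion down the indices.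
\<close>

lemma triangular_fixed_point_exists:
  fixes lam :: "'n::{finite, linorder} \<Rightarrow> 'k::field"
  assumes f: "\<And>i. f i \<in> polys_in {i<..}" and lam: "\<And>i. lam i \<noteq> 1"
  obtains a where "\<And>i. a i = lam i * a i + eval a (f i)"
proof -
  define R where "R = {(j, i :: 'n). i < j}"
  define F where "F g i = eval g (f i) / (1 - lam i)" for g i
  define a where "a = wfrec R F"
  have "acyclic R"
    by (rule acyclicI_order[where f = id]) (simp add: R_def)
  then have "wf R"
    by (intro finite_acyclic_wf) simp
  have "a i = lam i * a i + eval a (f i)" for i
  proof -
    have "a i = F (cut a R i) i"
      unfolding a_def by (rule wfrec[OF \<open>wf R\<close>])
    also have "\<dots> = F a i"
      unfolding F_def by (subst eval_cong[OF f]) (auto simp: cut_def R_def)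
    finally have "a i * (1 - lam i) = eval a (f i)"
      using lam[of i] by (simp add: F_def field_simps)
    then show ?thesis
      by (simp add: algebra_simps)
  qed
  with that show thesis by blast
qed

text \<open>
  Put \<open>l m\<close> for the product below. It suffices to treat a single variable and products. The
  image of \<open>Var i - Const (a i)\<close> is \<open>lam i * (Var i - Const (a i))\<close> plus a polynomial in later
  variables, which is lexicographically smaller. For products, both \<open>l\<close> and the shifted
  monomials are multiplicative, and adding exponents is strictly monotone, so each of the three
  mixed terms is of lower order. Here \<open>a\<close> may be any point.
\<close>

lemma triangular_endomorphism_leading_term:
  fixes a lam :: "'n::{finite, linorder} \<Rightarrow> 'k::comm_ring_1"
  assumes \<phi>: "algebra_endomorphism \<phi>"
    and f: "\<And>i. f i \<in> polys_in {i<..}"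
    and \<phi>_Var: "\<And>i. \<phi> (Var i) = Const (lam i) * Var i + f i"
  shows "\<phi> (shifted_monomial a m) -
      Const (\<Prod>i\<in>UNIV. lam i ^ Poly_Mapping.lookup m i) * shifted_monomial a m
    \<in> shifted_span a {..<m}"
proof -
  note hom = algebra_endomorphism_Const[OF \<phi>] algebra_endomorphism_diff[OF \<phi>]
    algebra_endomorphism_mult[OF \<phi>]
  let ?Y = "shifted_monomial a"
  let ?l = "\<lambda>m. \<Prod>i\<in>UNIV. lam i ^ Poly_Mapping.lookup m i"
  have "Poly_Mapping.keys m \<subseteq> UNIV" by simp
  then show ?thesis
  proof (induction m rule: exponent_induct)
    case zero
    have "\<phi> 1 = 1"
      using \<phi> by (simp add: algebra_endomorphism_def)
    then show ?case
      by (simp add: Const_1 shifted_span_def scal.span_zero)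
  next
    case (single i)
    let ?e = "Poly_Mapping.single i (Suc 0)"
    have l: "?l ?e = lam i"
      by (subst prod.remove[of _ i]) (auto simp: lookup_single when_def intro!: prod.neutral)
    have later: "m < ?e" if "Poly_Mapping.keys m \<subseteq> {i<..}" for m
    proof -
      have "Poly_Mapping.lookup m j = 0" if "j \<le> i" for j
        using that \<open>Poly_Mapping.keys m \<subseteq> {i<..}\<close> by (auto simp flip: not_in_keys_iff_lookup_eq_zero)
      then show ?thesis
        by (auto simp: less_poly_mapping.rep_eq less_fun_def lookup_single when_def intro!: exI[of _ i])
    qed
    have const: "Const c \<in> polys_in {i<..}" for c :: 'k
      by (auto simp: polys_in_def vars_def Const_def)
    have "f i + Const (lam i * a i - a i) \<in> shifted_span a {m. Poly_Mapping.keys m \<subseteq> {i<..}}"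
      using f[of i] const polys_in_subset_shifted_span by (intro shifted_span_add) blast+
    also have "\<dots> \<subseteq> shifted_span a {..<?e}"
      by (intro shifted_span_mono) (auto intro: later)
    also have "f i + Const (lam i * a i - a i) = \<phi> (?Y ?e) - Const (?l ?e) * ?Y ?e"
    proof -
      have "Const (lam i * a i - a i) = Const (lam i) * Const (a i) - Const (a i)"
        by (simp add: Const_def mult_single single_diff)
      then show ?thesis
        by (simp only: l) (simp add: hom \<phi>_Var algebra_simps)
    qed
    finally show ?case by simp
  next
    case (add m m')
    define u where "u = \<phi> (?Y m) - Const (?l m) * ?Y m"
    define v where "v = \<phi> (?Y m') - Const (?l m') * ?Y m'"
    have u: "u \<in> shifted_span a {..<m}" and v: "v \<in> shifted_span a {..<m'}"
      using add by (simp_all add: u_def v_def)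
    have "\<phi> (?Y (m + m')) - Const (?l (m + m')) * ?Y (m + m') =
        Const (?l m) * (?Y m * v) + (Const (?l m') * (u * ?Y m') + u * v)"
      by (simp add: u_def v_def shifted_monomial_add hom lookup_add power_add prod.distrib Const_mult
        algebra_simps)
    moreover have "?Y m * v \<in> shifted_span a {..<m + m'}"
      by (rule shifted_span_mult[OF shifted_span_base[of m "{m}"] v]) auto
    moreover have "u * ?Y m' \<in> shifted_span a {..<m + m'}"
      by (rule shifted_span_mult[OF u shifted_span_base[of m' "{m'}"]]) auto
    moreover have "u * v \<in> shifted_span a {..<m + m'}"
      by (rule shifted_span_mult[OF u v]) (auto intro: add_strict_mono)
    ultimately show ?case
      by (simp add: shifted_span_add shifted_span_Const_mult)
  qed
qed

text \<open>
  The fixed point makes the image vanish at \<open>a\<close>, and the absence of eigenvalue 1 on the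
  non-constant monomials lets the triangular map \<open>p \<mapsto> p - \<phi> p\<close> be inverted on their span.
\<close>

lemma range_id_minus_triangular_endomorphism:
  fixes a lam :: "'n::{finite, linorder} \<Rightarrow> 'k::field"
  assumes \<phi>: "algebra_endomorphism \<phi>"
    and f: "\<And>i. f i \<in> polys_in {i<..}"
    and \<phi>_Var: "\<And>i. \<phi> (Var i) = Const (lam i) * Var i + f i"
    and fixed: "\<And>i. a i = lam i * a i + eval a (f i)"
    and lam: "\<And>m :: 'n \<Rightarrow>\<^sub>0 nat. m \<noteq> 0 \<Longrightarrow> (\<Prod>i\<in>UNIV. lam i ^ Poly_Mapping.lookup m i) \<noteq> 1"
  shows "range (\<lambda>p. p - \<phi> p) = ideal_generated_by (range (\<lambda>i. Var i - Const (a i)))"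
proof -
  let ?R = "range (\<lambda>p. p - \<phi> p)"
  let ?Y = "shifted_monomial a"
  have eval_\<phi>: "eval a (\<phi> p) = eval a p" for p
    using fixed by (simp add: eval_endomorphism[OF \<phi>] \<phi>_Var)
  have R: "scal.subspace ?R"
    using E_derivation_id_minus_endomorphism[OF \<phi>]
    by (auto simp: E_derivation_def intro!: module_hom.subspace_image)
  have "?Y m \<in> ?R" if "m \<noteq> 0" for m
    using wf_exponent_less that
  proof (induction m rule: wf_induct_rule)
    case (less m)
    let ?l = "\<Prod>i\<in>UNIV. lam i ^ Poly_Mapping.lookup m i"
    define u where "u = \<phi> (?Y m) - Const ?l * ?Y m"
    have "u \<in> shifted_span a {..<m}"
      unfolding u_def by (rule triangular_endomorphism_leading_term[OF \<phi> f \<phi>_Var])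
    (* Both terms of u vanish at a, so u involves no constant monomial, which the induction
       hypothesis would not cover. *)
    moreover have "eval a u = 0"
      using less.prems by (simp add: u_def eval_\<phi> eval_shifted_monomial)
    ultimately have "u \<in> shifted_span a ({..<m} - {0})"
      using diff_eval_in_shifted_span[of u a "{..<m}"] by (simp add: Const_def)
    also have "\<dots> \<subseteq> ?R"
      using less.IH by (intro shifted_span_subset R) auto
    (* Adding u back turns the image of Y m into the multiple 1 - l of Y m. *)
    finally have "(?Y m - \<phi> (?Y m)) + u \<in> ?R"
      by (intro scal.subspace_add[OF R]) auto
    then have "scalar_mult (inverse (1 - ?l)) ((?Y m - \<phi> (?Y m)) + u) \<in> ?R"
      by (rule scal.subspace_scale[OF R])
    also have "(?Y m - \<phi> (?Y m)) + u = scalar_mult (1 - ?l) (?Y m)"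
      by (simp add: u_def scal.scale_left_diff_distrib) (simp add: scalar_mult_def)
    also have "scalar_mult (inverse (1 - ?l)) \<dots> = ?Y m"
      using lam[OF less.prems] by simp
    finally show ?case .
  qed
  then have "shifted_span a (UNIV - {0}) \<subseteq> ?R"
    by (intro shifted_span_subset R) auto
  moreover have "?R \<subseteq> {p. eval a p = 0}"
    by (auto simp: eval_\<phi>)
  ultimately show ?thesis
    unfolding ideal_generated_by_shifted_Var using eval_zero_subset_shifted_span[of a] by blast
qed

section \<open>The image of the \<open>\<E>\<close>-derivation\<close>

theorem proposition2p3:
  fixes \<phi> \<delta> :: "('n::{finite, linorder}, 'k::{alg_closed_field, field_char_0}) mpoly \<Rightarrow> ('n, 'k) mpoly"
    and lam :: "'n \<Rightarrow> 'k"
    and f :: "'n \<Rightarrow> ('n, 'k) mpoly"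
  assumes "E_derivation \<delta>"
    and "\<delta> = (\<lambda>p. p - \<phi> p)"
    and "algebra_endomorphism \<phi>"
    and "\<And>i. f i \<in> polys_in {i<..}"
    and "\<And>i. \<phi> (Var i) = Const (lam i) * Var i + f i"
    and "\<And>(k::'n) (e::'n \<Rightarrow> nat). (\<Sum>j\<in>{k..}. e j) \<ge> 1 \<Longrightarrow> (\<Prod>j\<in>{k..}. lam j ^ e j) \<noteq> 1"
  shows "(\<exists>a :: 'n \<Rightarrow> 'k. range \<delta> = ideal_generated_by (range (\<lambda>i. Var i - Const (a i)))) \<and>
    (range \<delta> = ideal_generated_by (range Var) \<longleftrightarrow> (\<forall>i. constant_term (f i) = 0))"
proof -
  have lam_monomial: "(\<Prod>i\<in>UNIV. lam i ^ Poly_Mapping.lookup m i) \<noteq> 1" if "m \<noteq> 0"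
    for m :: "'n \<Rightarrow>\<^sub>0 nat"
  proof -
    (* With k the first index, the condition on the lam j covers all monomials. *)
    have "{Min (UNIV :: 'n set)..} = UNIV"
      by auto
    moreover from that obtain i where "Poly_Mapping.lookup m i \<noteq> 0"
      by (auto simp: poly_mapping_eq_iff fun_eq_iff)
    then have "(\<Sum>i\<in>UNIV. Poly_Mapping.lookup m i) \<ge> 1"
      by (auto simp: Suc_le_eq intro: sum_pos2)
    ultimately show ?thesis
      using assms(6)[where k = "Min (UNIV :: 'n set)" and e = "Poly_Mapping.lookup m"] by simp
  qed
  have lam: "lam i \<noteq> 1" for i
  proof -
    have "(\<Prod>j\<in>UNIV. lam j ^ Poly_Mapping.lookup (Poly_Mapping.single i (Suc 0)) j) = lam i"
      by (subst prod.remove[of _ i]) (auto simp: lookup_single when_def intro!: prod.neutral)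
    moreover have "Poly_Mapping.single i (Suc 0) \<noteq> 0"
      by (metis lookup_single_eq lookup_zero nat.distinct(1))
    ultimately show ?thesis
      using lam_monomial by metis
  qed
  have image: "range \<delta> = ideal_generated_by (range (\<lambda>i. Var i - Const (a i)))"
    if "\<And>i. a i = lam i * a i + eval a (f i)" for a
    unfolding assms(2)
    using assms(3-5) that lam_monomial by (rule range_id_minus_triangular_endomorphism)
  obtain a where "\<And>i. a i = lam i * a i + eval a (f i)"
    using triangular_fixed_point_exists[of f lam] assms(4) lam by blast
  then have "\<exists>a. range \<delta> = ideal_generated_by (range (\<lambda>i. Var i - Const (a i)))"
    using image by blast
  moreover have "range \<delta> = ideal_generated_by (range Var) \<longleftrightarrow> (\<forall>i. constant_term (f i) = 0)"
  proof
    assume "\<forall>i. constant_term (f i) = 0"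
    then show "range \<delta> = ideal_generated_by (range Var)"
      using image[of "\<lambda>_. 0"] by (simp add: eval_zero_eq_constant_term Const_def)
  next
    assume "range \<delta> = ideal_generated_by (range Var)"
    then have "range \<delta> = {p. eval (\<lambda>_. 0) p = 0}"
      using ideal_generated_by_shifted_Var[of "\<lambda>_. 0"] by (simp add: Const_def)
    then have "eval (\<lambda>_. 0) (Var i - \<phi> (Var i)) = 0" for i
      by (metis (mono_tags, lifting) assms(2) mem_Collect_eq rangeI)
    then show "\<forall>i. constant_term (f i) = 0"
      by (simp add: assms(5) flip: eval_zero_eq_constant_term)
  qed
  ultimately show ?thesis ..
qed

end
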